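(* The equation $z^2 = \frac{T_x + T_y}{2}$ has infinitely many non-trivial solutions in integers $x, y, z$; that is, there are infinitely many non-constant three-term arithmetic progressions of the form $T_x, z^2, T_y$.
   Context: $T_n = \frac{n(n+1)(n+2)}{6}$ denotes the $n$-th tetrahedral number. A solution is non-trivial if $x \neq y$. *)

theory Defs
  imports Complex_Main
begin

definition tetrahedral :: "int \<Rightarrow> rat" where
  "tetrahedral n = of_int (n * (n + 1) * (n + 2)) / 6"

definition is_AP3 :: "rat \<Rightarrow> rat \<Rightarrow> rat \<Rightarrow> bool" where
  "is_AP3 a b c \<longleftrightarrow> b - a = c - b"

definition nonconstant_AP3 :: "rat \<Rightarrow> rat \<Rightarrow> rat \<Rightarrow> bool" where
  "nonconstant_AP3 a b c \<longleftrightarrow> is_AP3 a b c \<and> \<not> (a = b \<and> b = c)"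

end

theory Submission
  imports Defs
begin

text \<open>
  Put \<open>X = x + 1\<close>, \<open>Y = y + 1\<close>, \<open>S = X + Y\<close>, \<open>D = X - Y\<close>. The equation becomes
  \<open>S (S^2 + 3 D^2 - 4) = 48 z^2\<close>. Taking \<open>S = s^2\<close> and \<open>z = s w\<close> leaves
  \<open>3 (4 w - D) (4 w + D) = (s^2 - 2) (s^2 + 2)\<close>, which is solved by
  \<open>4 w - D = (s^2 + 2) / 3\<close> and \<open>4 w + D = s^2 - 2\<close>. For \<open>s = 6 k + 1\<close> all quantities are
  integers, which gives a polynomial family of solutions.
\<close>

lemma tetrahedral_strict_mono:
  assumes "0 \<le> m" "m < n"
  shows "tetrahedral m < tetrahedral n"
proof -
  have "m * (m + 1) * (m + 2) < n * (n + 1) * (n + 2)"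
    using assms by (intro mult_strict_mono) auto
  then show ?thesis
    unfolding tetrahedral_def by (intro divide_strict_right_mono) (auto simp only: of_int_less_iff)
qed

text \<open>With \<open>s = 6 k + 1\<close>, the factorization forces
  \<open>D = (s^2 - 4) / 3\<close> and \<open>w = (s^2 - 1) / 6\<close>; then
  \<open>x = (S + D) / 2 - 1\<close>, \<open>y = (S - D) / 2 - 1\<close> and
  \<open>z = s w\<close>.\<close>

definition family_x :: "int \<Rightarrow> int" where
  "family_x k = 8 * k * (3 * k + 1) - 1"

definition family_y :: "int \<Rightarrow> int" where
  "family_y k = 4 * k * (3 * k + 1)"

definition family_z :: "int \<Rightarrow> int" where
  "family_z k = 2 * k * (3 * k + 1) * (6 * k + 1)"

lemma family_is_AP3:
  "is_AP3 (tetrahedral (family_x k)) ((rat_of_int (family_z k))\<^sup>2) (tetrahedral (family_y k))"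
  unfolding is_AP3_def tetrahedral_def family_x_def family_y_def family_z_def
  by (simp add: field_simps power2_eq_square)

lemma family_y_strict_mono:
  assumes "0 \<le> j" "j < k"
  shows "family_y j < family_y k"
  unfolding family_y_def using assms by (auto intro: mult_strict_mono)

lemma family_y_less_family_x:
  assumes "1 \<le> k"
  shows "1 \<le> family_y k" "family_y k < family_x k"
proof -
  \<comment> \<open>For \<open>u = k (3 k + 1)\<close> the family reads \<open>x = 8 u - 1\<close>,
    \<open>y = 4 u\<close>, so both claims follow from \<open>u \<ge> 1\<close>.\<close>
  have "1 * 1 \<le> k * (3 * k + 1)"
    using assms by (intro mult_mono) auto
  then show "1 \<le> family_y k" "family_y k < family_x k"
    unfolding family_x_def family_y_def by (auto simp: algebra_simps)
qed

lemma infinite_tetrahedral_square_AP3: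
  "infinite {(tetrahedral x, (rat_of_int z)\<^sup>2, tetrahedral y) | x y z.
     x \<ge> 1 \<and> y \<ge> 1 \<and>
     nonconstant_AP3 (tetrahedral x) ((rat_of_int z)\<^sup>2) (tetrahedral y)}"
    (is "infinite ?A")
proof -
  \<comment> \<open>The shift skips \<open>k = 0\<close>, where \<open>x = -1\<close>,
    \<open>y = 0\<close> and \<open>z = 0\<close> give the constant progression 0, 0, 0.\<close>
  define f where "f n = (let k = int n + 1 in
    (tetrahedral (family_x k), (rat_of_int (family_z k))\<^sup>2, tetrahedral (family_y k)))" for n
  \<comment> \<open>The last term of the progression alone already separates the values of
    \<open>f\<close>.\<close>
  have "strict_mono (\<lambda>n. tetrahedral (family_y (int n + 1)))"
    by (intro strict_monoI tetrahedral_strict_mono family_y_strict_mono)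
       (auto simp: family_y_def)
  then have "inj f"
    by (auto simp: f_def Let_def inj_def dest: strict_mono_eq)
  moreover have "range f \<subseteq> ?A"
  proof
    fix t
    assume "t \<in> range f"
    then obtain n where t: "t = f n" by blast
    define k where "k = int n + 1"
    have y: "1 \<le> family_y k" and xy: "family_y k < family_x k"
      using family_y_less_family_x[of k] by (auto simp: k_def)
    have "tetrahedral (family_y k) < tetrahedral (family_x k)"
      using y xy by (intro tetrahedral_strict_mono) auto
    then have "nonconstant_AP3 (tetrahedral (family_x k)) ((rat_of_int (family_z k))\<^sup>2)
        (tetrahedral (family_y k))"
      using family_is_AP3 by (auto simp: nonconstant_AP3_def)
    moreover have "1 \<le> family_x k"
      using y xy by linarith
    ultimately show "t \<in> ?A"
      unfolding t f_def Let_def k_def[symmetric] using y by blast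
  qed
  ultimately show ?thesis
    using infinite_iff_countable_subset by blast
qed

theorem theorem4p2:
  shows "infinite {(x, y, z).
           (rat_of_int z)\<^sup>2 = (tetrahedral x + tetrahedral y) / 2 \<and> x \<noteq> y}
       \<and> infinite {(tetrahedral x, (rat_of_int z)\<^sup>2, tetrahedral y) | x y z.
           x \<ge> 1 \<and> y \<ge> 1 \<and>
           nonconstant_AP3 (tetrahedral x) ((rat_of_int z)\<^sup>2) (tetrahedral y)}"
    (is "infinite ?S \<and> infinite ?A")
proof
  let ?g = "\<lambda>(x, y, z). (tetrahedral x, (rat_of_int z)\<^sup>2, tetrahedral y)"
  \<comment> \<open>A finite \<open>?S\<close> would have a finite image, so the infinitude of
    \<open>?A\<close> carries over to \<open>?S\<close>.\<close>
  have "?A \<subseteq> ?g ` ?S"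
  proof
    fix t
    assume "t \<in> ?A"
    then obtain x y z where t: "t = ?g (x, y, z)"
      and ap: "nonconstant_AP3 (tetrahedral x) ((rat_of_int z)\<^sup>2) (tetrahedral y)"
      by auto
    \<comment> \<open>If \<open>x = y\<close>, the middle term equals both outer ones and the
      progression is constant.\<close>
    have "(rat_of_int z)\<^sup>2 = (tetrahedral x + tetrahedral y) / 2" "x \<noteq> y"
      using ap by (auto simp: nonconstant_AP3_def is_AP3_def field_simps)
    then have "(x, y, z) \<in> ?S" by simp
    then show "t \<in> ?g ` ?S" unfolding t by (rule imageI)
  qed
  then show "infinite ?S"
    using infinite_tetrahedral_square_AP3 finite_surj by blast
  show "infinite ?A"
    by (rule infinite_tetrahedral_square_AP3)
qed

end
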